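(* Let $n > 3$ and $N = \{1,2,\ldots,n\}$. For any additive measure $\nu$ on $N$ with $\nu(\{i\}) \neq 0$ for all $i \in N$, there exists a strictly superadditive, but not necessarily supermodular, measure $\mu$ on $N$ such that $\nu(A) \geq \mu(A)$ for all $A \subseteq N$.
   Context: Let $\mathcal{P}(N)$ denote the power set of $N$. An additive measure on $N$ is a set function $\nu : \mathcal{P}(N) \to [0,1]$ such that $\nu(\emptyset) = 0$, $\nu(N) = 1$, and $\nu(A \cup B) = \nu(A) + \nu(B)$ for all $A, B \subseteq N$ with $A \cap B = \emptyset$. A fuzzy measure on $N$ is a set function $\mu : \mathcal{P}(N) \to [0,1]$ such that $\mu(\emptyset) = 0$, $\mu(N) = 1$, and $A \subseteq B \subseteq N$ implies $\mu(A) \leq \mu(B)$. A strictly superadditive measure on $N$ is a fuzzy measure $\mu$ on $N$ such that $\mu(A \cup B) > \mu(A) + \mu(B)$ for all nonempty $A, B \subseteq N$ with $A \cap B = \emptyset$. A supermodular measure on $N$ is a fuzzy measure $\mu$ on $N$ such that $\mu(A \cup B) + \mu(A \cap B) \geq \mu(A) + \mu(B)$ for all $A, B \subseteq N$ with $A \cap B \neq A$ and $A \cap B \neq B$. "Not necessarily supermodular" means that supermodularity of $\mu$ is neither required nor asserted. *)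

theory Defs
  imports Complex_Main "HOL-Library.FuncSet"
begin

(* Set functions on the power set of N are total functions of type 'a set => real;
   their values outside Pow N are irrelevant to all notions below. *)

definition additive_measure :: "'a set \<Rightarrow> ('a set \<Rightarrow> real) \<Rightarrow> bool" where
  "additive_measure N \<nu> \<longleftrightarrow>
     \<nu> \<in> Pow N \<rightarrow> {0..1} \<and> \<nu> {} = 0 \<and> \<nu> N = 1 \<and>
     (\<forall>A B. A \<subseteq> N \<longrightarrow> B \<subseteq> N \<longrightarrow> A \<inter> B = {} \<longrightarrow> \<nu> (A \<union> B) = \<nu> A + \<nu> B)"

definition fuzzy_measure :: "'a set \<Rightarrow> ('a set \<Rightarrow> real) \<Rightarrow> bool" where
  "fuzzy_measure N \<mu> \<longleftrightarrow>
     \<mu> \<in> Pow N \<rightarrow> {0..1} \<and> \<mu> {} = 0 \<and> \<mu> N = 1 \<and>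
     (\<forall>A B. A \<subseteq> B \<longrightarrow> B \<subseteq> N \<longrightarrow> \<mu> A \<le> \<mu> B)"

definition strictly_superadditive_measure :: "'a set \<Rightarrow> ('a set \<Rightarrow> real) \<Rightarrow> bool" where
  "strictly_superadditive_measure N \<mu> \<longleftrightarrow>
     fuzzy_measure N \<mu> \<and>
     (\<forall>A B. A \<subseteq> N \<longrightarrow> B \<subseteq> N \<longrightarrow> A \<noteq> {} \<longrightarrow> B \<noteq> {} \<longrightarrow> A \<inter> B = {} \<longrightarrow>
        \<mu> (A \<union> B) > \<mu> A + \<mu> B)"

end

theory Submission
  imports Defs
begin

text \<open>The witness is \<open>\<lambda>A. (\<nu> A)\<^sup>2\<close>. On [0,1] squaring is
  increasing, fixes 0 and 1 and satisfies x^2 \<le> x, so the square of \<nu> is again a fuzzy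
  measure and lies below \<nu>. For disjoint A and B, additivity turns the square on the union into
  (\<nu> A + \<nu> B)^2, which exceeds the sum of the squares by 2 * \<nu> A * \<nu> B. This surplus
  is positive for nonempty sets by \<open>additive_measure_pos\<close>;
  \<open>strictly_superadditive_measure_square\<close> assembles these facts.\<close>

lemma additive_measure_range:
  assumes "additive_measure N \<nu>" "A \<subseteq> N"
  shows "0 \<le> \<nu> A" "\<nu> A \<le> 1"
  using assms by (auto simp: additive_measure_def Pi_iff)

lemma additive_measure_Un:
  assumes "additive_measure N \<nu>" "A \<subseteq> N" "B \<subseteq> N" "A \<inter> B = {}"
  shows "\<nu> (A \<union> B) = \<nu> A + \<nu> B"
  using assms by (simp add: additive_measure_def)

lemma additive_measure_mono:
  assumes "additive_measure N \<nu>" "A \<subseteq> B" "B \<subseteq> N"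
  shows "\<nu> A \<le> \<nu> B"
proof -
  have "\<nu> (A \<union> (B - A)) = \<nu> A + \<nu> (B - A)"
    using assms by (intro additive_measure_Un[OF assms(1)]) auto
  moreover have "\<nu> (B - A) \<ge> 0"
    using assms by (intro additive_measure_range[OF assms(1)]) auto
  moreover have "A \<union> (B - A) = B"
    using assms(2) by blast
  ultimately show ?thesis
    by simp
qed

text \<open>A nonzero singleton has positive mass because \<nu> is nonnegative, and monotonicity
  passes this on to every set containing the point. This is where the condition on singletons
  enters; it makes superadditivity strict.\<close>

lemma additive_measure_pos:
  assumes "additive_measure N \<nu>" "\<And>i. i \<in> N \<Longrightarrow> \<nu> {i} \<noteq> 0" "A \<subseteq> N" "A \<noteq> {}"
  shows "\<nu> A > 0"
proof -
  obtain i where i: "i \<in> A"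
    using assms(4) by blast
  then have "\<nu> {i} > 0"
    using additive_measure_range(1)[OF assms(1), of "{i}"] assms(2)[of i] assms(3) by auto
  also have "\<nu> {i} \<le> \<nu> A"
    using additive_measure_mono[OF assms(1)] i assms(3) by simp
  finally show ?thesis .
qed

lemma strictly_superadditive_measure_square:
  assumes \<nu>: "additive_measure N \<nu>" and nz: "\<And>i. i \<in> N \<Longrightarrow> \<nu> {i} \<noteq> 0"
  shows "strictly_superadditive_measure N (\<lambda>A. (\<nu> A)\<^sup>2)"
proof -
  have "fuzzy_measure N (\<lambda>A. (\<nu> A)\<^sup>2)"
    unfolding fuzzy_measure_def
  proof (intro conjI allI impI)
    show "(\<lambda>A. (\<nu> A)\<^sup>2) \<in> Pow N \<rightarrow> {0..1}"
      using additive_measure_range[OF \<nu>] by (auto simp: power_le_one)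
    show "(\<nu> {})\<^sup>2 = 0" "(\<nu> N)\<^sup>2 = 1"
      using \<nu> by (auto simp: additive_measure_def)
    show "(\<nu> A)\<^sup>2 \<le> (\<nu> B)\<^sup>2" if "A \<subseteq> B" "B \<subseteq> N" for A B
      using additive_measure_range(1)[OF \<nu>, of A] additive_measure_mono[OF \<nu> that] that
      by (intro power_mono) auto
  qed
  moreover have "(\<nu> (A \<union> B))\<^sup>2 > (\<nu> A)\<^sup>2 + (\<nu> B)\<^sup>2"
    if "A \<subseteq> N" "B \<subseteq> N" "A \<noteq> {}" "B \<noteq> {}" "A \<inter> B = {}" for A B
  proof -
    have "\<nu> (A \<union> B) = \<nu> A + \<nu> B"
      using additive_measure_Un[OF \<nu>] that by simp
    \<comment> \<open>Half of the cross term in the expanded square, hence half of the gap to be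
      shown positive.\<close>
    moreover have "\<nu> A * \<nu> B > 0"
      using additive_measure_pos[OF \<nu> nz] that by simp
    ultimately show ?thesis
      by (simp add: power2_sum)
  qed
  ultimately show ?thesis
    unfolding strictly_superadditive_measure_def by blast
qed

theorem corollary2:
  fixes n :: nat and N :: "nat set" and \<nu> :: "nat set \<Rightarrow> real"
  assumes "n > 3"
    and "N = {1..n}"
    and "additive_measure N \<nu>"
    and "\<And>i. i \<in> N \<Longrightarrow> \<nu> {i} \<noteq> 0"
  shows "\<exists>\<mu>. strictly_superadditive_measure N \<mu> \<and> (\<forall>A. A \<subseteq> N \<longrightarrow> \<nu> A \<ge> \<mu> A)"
proof (intro exI conjI allI impI)
  \<comment> \<open>\<open>exI\<close> leaves the witness schematic; unification with this goal
    fixes it as the square of \<nu>.\<close>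
  show "strictly_superadditive_measure N (\<lambda>A. (\<nu> A)\<^sup>2)"
    using assms(3,4) by (rule strictly_superadditive_measure_square)
  \<comment> \<open>Multiplying \<nu> A \<ge> 0 by a factor of at most 1, here \<nu> A itself,
    cannot enlarge it.\<close>
  show "(\<nu> A)\<^sup>2 \<le> \<nu> A" if "A \<subseteq> N" for A
    using additive_measure_range[OF assms(3) that] by (simp add: power2_eq_square mult_left_le)
qed

end
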